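(* Let $m,n\ge1$, and let ${\boldsymbol{\omega}}=({\boldsymbol{\alpha}},{\boldsymbol{\beta}})\in\mathbb{R}_{>0}^m\times\mathbb{R}_{>0}^n$ with $\sum_i\alpha_i=\sum_j\beta_j=1$. Then $\mathbf{BA}_{\boldsymbol{\omega}}\subset \mathbf{DI}_{\infty,{\boldsymbol{\omega}}}$.
   Context: For ${\bf x}\in\mathbb{R}^m$, ${\bf y}\in\mathbb{R}^n$, $\|{\bf x}\|_{{\boldsymbol{\alpha}}}=\max_i|x_i|^{1/\alpha_i}$ and $\|{\bf y}\|_{{\boldsymbol{\beta}}}=\max_j|y_j|^{1/\beta_j}$. For $\psi:\mathbb{R}_{>0}\to\mathbb{R}_{>0}$, $D_{\infty,{\boldsymbol{\omega}}}(\psi)$ is the set of real $m\times n$ matrices $A$ such that for all sufficiently large $t$ there is $({\bf p},{\bf q})\in\mathbb{Z}^m\times(\mathbb{Z}^n\smallsetminus\{{\bf 0}\})$ with $\|A{\bf q}-{\bf p}\|_{{\boldsymbol{\alpha}}}<\psi(t)$ and $\|{\bf q}\|_{{\boldsymbol{\beta}}}<t$. With $\psi_1(t)=1/t$, $\mathbf{DI}_{\infty,{\boldsymbol{\omega}}}=\bigcup_{0<c<1}D_{\infty,{\boldsymbol{\omega}}}(c\psi_1)$. The set of ${\boldsymbol{\omega}}$-badly approximable matrices is $\mathbf{BA}_{\boldsymbol{\omega}}=\{A: \inf_{{\bf p}\in\mathbb{Z}^m,{\bf q}\in\mathbb{Z}^n\smallsetminus\{{\bf 0}\}}\|A{\bf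 q}-{\bf p}\|_{{\boldsymbol{\alpha}}}\|{\bf q}\|_{{\boldsymbol{\beta}}}>0\}$. *)

theory Defs
  imports "HOL-Analysis.Analysis"
begin

text \<open>The weighted quasi-norm max over i of |x_i|^(1/w_i). Since all weights are positive,
  the convention \<open>0 powr a = 0\<close> is the correct value for vanishing coordinates.\<close>

definition wnorm :: "real ^ 'k \<Rightarrow> real ^ 'k \<Rightarrow> real" where
  "wnorm w x = Max (range (\<lambda>i. \<bar>x $ i\<bar> powr (1 / w $ i)))"

definition real_vec :: "int ^ 'k \<Rightarrow> real ^ 'k" where
  "real_vec z = (\<chi> i. real_of_int (z $ i))"

text \<open>The pair of weight vectors is passed as two arguments \<open>\<alpha>\<close> and \<open>\<beta>\<close>. Only the values of
  \<open>\<psi>\<close> at large positive arguments matter, so \<open>\<psi>\<close> is taken to be a total function.\<close>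

definition D_inf :: "real ^ 'm \<Rightarrow> real ^ 'n \<Rightarrow> (real \<Rightarrow> real) \<Rightarrow> (real ^ 'n ^ 'm) set" where
  "D_inf \<alpha> \<beta> \<psi> =
    {A. \<forall>\<^sub>F t in at_top. \<exists>(p :: int ^ 'm) (q :: int ^ 'n). q \<noteq> 0 \<and>
          wnorm \<alpha> (A *v real_vec q - real_vec p) < \<psi> t \<and> wnorm \<beta> (real_vec q) < t}"

definition psi1 :: "real \<Rightarrow> real" where
  "psi1 t = 1 / t"

definition DI_inf :: "real ^ 'm \<Rightarrow> real ^ 'n \<Rightarrow> (real ^ 'n ^ 'm) set" where
  "DI_inf \<alpha> \<beta> = (\<Union>c\<in>{0<..<1}. D_inf \<alpha> \<beta> (\<lambda>t. c * psi1 t))"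

text \<open>The infimum below is over a nonempty set of nonnegative reals, so the real-valued infimum
  is the genuine one.\<close>

definition BA :: "real ^ 'm \<Rightarrow> real ^ 'n \<Rightarrow> (real ^ 'n ^ 'm) set" where
  "BA \<alpha> \<beta> =
    {A. (INF (p, q) \<in> (UNIV :: (int ^ 'm) set) \<times> (UNIV - {0} :: (int ^ 'n) set).
           wnorm \<alpha> (A *v real_vec q - real_vec p) * wnorm \<beta> (real_vec q)) > 0}"

end

theory Submission
  imports Defs "HOL-Complex_Analysis.Great_Picard" "HOL-Real_Asymp.Real_Asymp"
begin

text \<open>
  If \<open>A\<close> is not in \<open>DI_inf\<close>, there are times \<open>t\<close> tending to infinity at which the unimodular lattices
  with points \<open>(t\<^sup>\<alpha> (A q - p), t\<^sup>-\<^sup>\<beta> q)\<close> have no nonzero point in cubes \<open>(-c, c)\<^sup>d\<close> with \<open>c \<rightarrow> 1\<close>. A limit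
  \<open>M\<close> of these lattices along a subsequence is a lattice for which the translates of \<open>[0, 1)\<^sup>d\<close> tile
  space. By an argument of Keller, every nonzero vector of \<open>M\<close> then has a nonzero integer coordinate.
  Instead of the theorem of Hajos it suffices to know that \<open>M\<close> has a nonzero vector on a
  coordinate axis: a group covered by finitely many pure subgroups is equal to one of them, so some
  coordinate is rational on all of \<open>M\<close>, and one passes to the sublattice on which it vanishes and
  repeats. But if \<open>A\<close> is badly approximable, the products of the quasi-norms of the two components
  of nonzero lattice points stay bounded away from zero in the limit, so that \<open>M\<close> contains no nonzero
  vector on an axis.
\<close>

subsection \<open>Subgroups covered by pure subgroups\<close>

definition additive_subgroup :: "'a::ab_group_add set \<Rightarrow> bool" where
  "additive_subgroup L \<longleftrightarrow> 0 \<in> L \<and> (\<forall>u\<in>L. \<forall>v\<in>L. u - v \<in> L)"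

lemma additive_subgroup_zero: "additive_subgroup L \<Longrightarrow> 0 \<in> L"
  and additive_subgroup_diff: "additive_subgroup L \<Longrightarrow> u \<in> L \<Longrightarrow> v \<in> L \<Longrightarrow> u - v \<in> L"
  by (auto simp: additive_subgroup_def)

lemma additive_subgroup_minus: "additive_subgroup L \<Longrightarrow> u \<in> L \<Longrightarrow> - u \<in> L"
  by (metis additive_subgroup_diff additive_subgroup_zero diff_0)

lemma additive_subgroup_add: "additive_subgroup L \<Longrightarrow> u \<in> L \<Longrightarrow> v \<in> L \<Longrightarrow> u + v \<in> L"
  by (metis additive_subgroup_diff additive_subgroup_minus diff_minus_eq_add)

lemma additive_subgroup_scaleR_nat:
  fixes L :: "'a::real_vector set"
  assumes "additive_subgroup L" "u \<in> L"
  shows "real k *\<^sub>R u \<in> L"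
proof (induction k)
  case (Suc k)
  have "real (Suc k) *\<^sub>R u = real k *\<^sub>R u + u"
    by (simp add: algebra_simps)
  with Suc assms show ?case by (simp add: additive_subgroup_add)
qed (use assms in \<open>simp add: additive_subgroup_zero\<close>)

text \<open>Take \<open>w0\<close> outside of one subgroup \<open>H i\<close> and \<open>w1\<close> outside of all others. The points \<open>w0 + k w1\<close>
  avoid \<open>H i\<close>, so two of them lie in the same \<open>H j\<close>, and purity gives \<open>w1 \<in> H j\<close>.\<close>

lemma additive_subgroup_covered_by_pure:
  fixes L :: "'a::real_vector set"
  assumes L: "additive_subgroup L" and "finite I" and cover: "L \<subseteq> (\<Union>i\<in>I. H i)"
    and H: "\<And>i. i \<in> I \<Longrightarrow> additive_subgroup (H i)"
    and pure: "\<And>i u k. i \<in> I \<Longrightarrow> k > 0 \<Longrightarrow> real k *\<^sub>R u \<in> H i \<Longrightarrow> u \<in> H i"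
  shows "\<exists>i\<in>I. L \<subseteq> H i"
  using assms(2-)
proof (induction I rule: finite_induct)
  case empty
  then show ?case using additive_subgroup_zero[OF L] by auto
next
  case (insert i I)
  show ?case
  proof (rule ccontr)
    assume contra: "\<not> ?thesis"
    then obtain w0 where w0: "w0 \<in> L" "w0 \<notin> H i" by blast
    have "\<not> L \<subseteq> (\<Union>i\<in>I. H i)" using insert contra by blast
    then obtain w1 where w1: "w1 \<in> L" "\<And>j. j \<in> I \<Longrightarrow> w1 \<notin> H j" by blast
    then have w1i: "w1 \<in> H i" using insert.prems(1) by blast
    have Hi: "additive_subgroup (H i)" using insert.prems by blast
    have "\<exists>j\<in>I. w0 + real k *\<^sub>R w1 \<in> H j" for k
    proof -
      have "w0 + real k *\<^sub>R w1 \<in> L"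
        using L w0 w1 by (intro additive_subgroup_add additive_subgroup_scaleR_nat)
      moreover have "w0 + real k *\<^sub>R w1 \<notin> H i"
      proof
        assume "w0 + real k *\<^sub>R w1 \<in> H i"
        then have "(w0 + real k *\<^sub>R w1) - real k *\<^sub>R w1 \<in> H i"
          using Hi w1i by (intro additive_subgroup_diff additive_subgroup_scaleR_nat)
        then show False using w0 by simp
      qed
      ultimately show ?thesis using insert.prems(1) by blast
    qed
    then obtain f where f: "\<And>k. f k \<in> I" "\<And>k. w0 + real k *\<^sub>R w1 \<in> H (f k)" by metis
    have "finite (range f)" using f(1) insert.hyps(1) by (meson finite_subset image_subsetI)
    then have "\<not> inj f" using finite_imageD by blast
    then obtain a b where "a \<noteq> b" and "f a = f b" by (auto simp: inj_on_def)
    then obtain a b where ab: "a < b" "f a = f b"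
      by (metis linorder_neqE_nat)
    have "(w0 + real b *\<^sub>R w1) - (w0 + real a *\<^sub>R w1) \<in> H (f a)"
      using f ab insert.prems(2) by (metis additive_subgroup_diff insertI2)
    moreover have "(w0 + real b *\<^sub>R w1) - (w0 + real a *\<^sub>R w1) = real (b - a) *\<^sub>R w1"
      using ab by (simp add: algebra_simps of_nat_diff)
    ultimately show False
      using insert.prems(3)[of "f a" "b - a" w1] f(1)[of a] ab w1(2) by auto
  qed
qed

subsection \<open>Integer coordinates in lattice tilings by cubes\<close>

text \<open>Half-open unit intervals that tile the line leave no gap, so each has a neighbour
  starting exactly where it ends; repeating this in both directions gives a coset of \<int>. The
  left end point is a function \<open>f\<close> because the tiles on a line will be vectors with
  \<open>f\<close> a coordinate, and the bijection also records that this coordinate separates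
  them.\<close>

lemma interval_tiling_integral:
  fixes f :: "'a \<Rightarrow> real"
  assumes tile: "\<And>x. \<exists>!t. t \<in> T \<and> f t \<le> x \<and> x < f t + 1"
  obtains a where "bij_betw f T ((\<lambda>k. a + of_int k) ` UNIV)"
proof -
  \<comment> \<open>Otherwise the larger of the two left end points would be covered twice.\<close>
  have uniq: "s = t" if "s \<in> T" "t \<in> T" "\<bar>f s - f t\<bar> < 1" for s t
    using tile[of "max (f s) (f t)"] that by (auto simp: max_def abs_less_iff split: if_splits)
  have up: "\<exists>s\<in>T. f s = f t + 1" if t: "t \<in> T" for t
  proof -
    obtain s where s: "s \<in> T" "f s \<le> f t + 1" "f t + 1 < f s + 1" using tile[of "f t + 1"] by blast
    show ?thesis using uniq[of s t] s t by force
  qed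
  have down: "\<exists>s\<in>T. f s = f t - 1" if t: "t \<in> T" for t
  proof -
    \<comment> \<open>The tile \<open>s\<close> covering \<open>f t - 1\<close> starts after
      \<open>f t - 2\<close>. Its right neighbour therefore starts at distance less than 1 from
      \<open>f t\<close>, and so is \<open>t\<close> itself.\<close>
    obtain s where s: "s \<in> T" "f s \<le> f t - 1" "f t - 1 < f s + 1" using tile[of "f t - 1"] by blast
    obtain r where r: "r \<in> T" "f r = f s + 1" using up s by blast
    then have "r = t" using uniq[of r t] s t by linarith
    then show ?thesis using s r by force
  qed
  obtain t0 where t0: "t0 \<in> T" using tile by blast
  have all: "\<exists>s\<in>T. f s = f t0 + of_int k" for k
  proof (induction k rule: int_induct[where k = 0])
    case base
    then show ?case using t0 by force
  next
    case (step1 i)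
    then obtain s where "s \<in> T" "f s = f t0 + of_int i" by blast
    then show ?case using up[of s] by (force simp: algebra_simps)
  next
    case (step2 i)
    then obtain s where "s \<in> T" "f s = f t0 + of_int i" by blast
    then show ?case using down[of s] by (force simp: algebra_simps)
  qed
  have "f ` T = (\<lambda>k. f t0 + of_int k) ` UNIV"
  proof (intro equalityI subsetI)
    fix y assume "y \<in> f ` T"
    then obtain t where t: "t \<in> T" "y = f t" by blast
    obtain s where s: "s \<in> T" "f s = f t0 + of_int \<lfloor>f t - f t0\<rfloor>" using all by blast
    have "s = t" using uniq[of s t] s t by linarith
    with s t show "y \<in> (\<lambda>k. f t0 + of_int k) ` UNIV" by auto
  next
    fix y assume "y \<in> (\<lambda>k. f t0 + of_int k) ` UNIV"
    then obtain k where "y = f t0 + of_int k" by blast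
    then show "y \<in> f ` T" using all[of k] by (metis image_eqI)
  qed
  moreover have "inj_on f T"
    by (rule inj_onI) (use uniq in auto)
  ultimately show ?thesis using that[of "f t0"] by (simp add: bij_betw_def)
qed

section \<open>Representatives of the reals modulo 1\<close>

definition fundamental_domain :: "real set \<Rightarrow> bool" where
  "fundamental_domain E \<longleftrightarrow> (\<forall>x. \<exists>!k::int. x + of_int k \<in> E)"

lemma fundamental_domain_unit: "fundamental_domain {0..<1}"
  unfolding fundamental_domain_def
proof
  fix x :: real
  show "\<exists>!k::int. x + of_int k \<in> {0..<1}"
    by (rule ex1I[of _ "- \<lfloor>x\<rfloor>"]) (auto, linarith+)
qed

text \<open>Representatives can be chosen independently in each class modulo 1. By hypothesis 0 and
  \<open>z\<close> are either equal or in different classes, so both can be chosen.\<close>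

lemma fundamental_domain_through:
  assumes "z \<in> \<int> \<Longrightarrow> z = 0"
  obtains E where "fundamental_domain E" "0 \<in> E" "z \<in> E"
proof -
  define E where "E = {y. (y - z \<in> \<int> \<and> y = z) \<or> (y - z \<notin> \<int> \<and> y \<in> {0..<1})}"
  have "fundamental_domain E"
    unfolding fundamental_domain_def
  proof
    fix x :: real
    show "\<exists>!k::int. x + of_int k \<in> E"
    proof (cases "x - z \<in> \<int>")
      case True
      then obtain l where l: "x - z = of_int l" by (auto elim: Ints_cases)
      have "x + of_int k - z \<in> \<int>" for k :: int
      proof -
        have "x + of_int k - z = of_int (l + k)" using l by simp
        then show ?thesis by (metis Ints_of_int)
      qed
      moreover have "x + of_int k = z \<longleftrightarrow> k = - l" for k :: int
        using l by linarith
      ultimately show ?thesis unfolding E_def by auto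
    next
      case False
      have "x + of_int k - z \<notin> \<int>" for k :: int
      proof
        assume "x + of_int k - z \<in> \<int>"
        then have "(x + of_int k - z) - of_int k \<in> \<int>" by (rule Ints_diff) simp
        then show False using False by (simp add: algebra_simps)
      qed
      then show ?thesis
        using fundamental_domain_unit unfolding E_def fundamental_domain_def by simp
    qed
  qed
  moreover have "0 \<in> E"
  proof (cases "z \<in> \<int>")
    case True
    then show ?thesis using assms by (simp add: E_def)
  next
    case False
    then show ?thesis by (simp add: E_def Ints_minus[of "-z"] minus_in_Ints_iff)
  qed
  moreover have "z \<in> E" by (simp add: E_def)
  ultimately show ?thesis using that by blast
qed

text \<open>On a line parallel to a coordinate axis the tiles lie at the points of a coset of \<open>\<int>\<close>, hence the
  interval \<open>[0, 1)\<close> in this coordinate may be exchanged for any other fundamental domain.\<close>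

lemma tiling_replace_domains:
  fixes T :: "(real ^ 'k) set"
  assumes tile: "\<And>x. \<exists>!t. t \<in> T \<and> (\<forall>i. x $ i - t $ i \<in> {0..<1})"
    and E: "\<And>i. fundamental_domain (E i)" and "finite S"
  shows "\<exists>!t. t \<in> T \<and> (\<forall>i. x $ i - t $ i \<in> (if i \<in> S then E i else {0..<1}))"
  using \<open>finite S\<close>
proof (induction S arbitrary: x rule: finite_induct)
  case empty
  then show ?case using tile by simp
next
  case (insert j S)
  define F where "F = (\<lambda>S i. if i \<in> S then E i else {0..<1::real})"
  \<comment> \<open>These are the tiles that meet the line through \<open>x\<close> in direction
    \<open>j\<close> when the domains in \<open>S\<close> are already exchanged. As \<open>j\<close>
    is not in \<open>S\<close>, the induction hypothesis at the points of this line says that they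
    tile it by half-open unit intervals.\<close>
  define T' where "T' = {t \<in> T. \<forall>i. i \<noteq> j \<longrightarrow> x $ i - t $ i \<in> F S i}"
  have split: "(t \<in> T \<and> (\<forall>i. (\<chi> i. if i = j then y else x $ i) $ i - t $ i \<in> F S i)) \<longleftrightarrow>
      t \<in> T' \<and> t $ j \<le> y \<and> y < t $ j + 1" for y t
    using \<open>j \<notin> S\<close> unfolding T'_def F_def by (auto split: if_splits)
  have "\<exists>!t. t \<in> T' \<and> t $ j \<le> y \<and> y < t $ j + 1" for y
    using insert.IH[of "\<chi> i. if i = j then y else x $ i"] unfolding F_def[symmetric] split
    using split[unfolded F_def] by (simp add: F_def)
  then obtain a where a: "bij_betw (\<lambda>t. t $ j) T' ((\<lambda>k. a + of_int k) ` UNIV)"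
    by (rule interval_tiling_integral)
  \<comment> \<open>The \<open>j\<close>-th coordinates of these tiles form the coset of \<int>
    through \<open>a\<close>, so a fundamental domain selects exactly one of them.\<close>
  obtain k where k: "x $ j - a + of_int k \<in> E j" "\<And>l. x $ j - a + of_int l \<in> E j \<Longrightarrow> l = k"
    using E[of j] unfolding fundamental_domain_def by metis
  have "a + of_int (- k) \<in> (\<lambda>t. t $ j) ` T'"
    using a unfolding bij_betw_def by blast
  then obtain t where t: "t \<in> T'" "t $ j = a - of_int k" by force
  have char: "(s \<in> T \<and> (\<forall>i. x $ i - s $ i \<in> F (insert j S) i)) \<longleftrightarrow> s \<in> T' \<and> x $ j - s $ j \<in> E j" for s
    using \<open>j \<notin> S\<close> unfolding T'_def F_def by auto
  have "\<exists>!s. s \<in> T' \<and> x $ j - s $ j \<in> E j"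
  proof (rule ex1I[of _ t])
    have "x $ j - t $ j = x $ j - a + of_int k" using t by simp
    then show "t \<in> T' \<and> x $ j - t $ j \<in> E j" using t k(1) by metis
    fix s assume s: "s \<in> T' \<and> x $ j - s $ j \<in> E j"
    then obtain l where l: "s $ j = a + of_int l" using a unfolding bij_betw_def by blast
    then have "- l = k" using s k(2)[of "- l"] by (simp add: algebra_simps)
    then have "s $ j = t $ j" using l t by auto
    then show "s = t" using a s t unfolding bij_betw_def inj_on_def by blast
  qed
  then show ?case using char unfolding F_def by simp
qed

text \<open>If no coordinate of \<open>v\<close> is a nonzero integer, then fundamental domains containing both \<open>0\<close> and
  \<open>- v $ i\<close> make the tiles of \<open>0\<close> and \<open>v\<close> overlap.\<close>

lemma lattice_tiling_integer_coordinate: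
  fixes L :: "(real ^ 'k) set"
  assumes tile: "\<And>x. \<exists>!t. t \<in> L \<and> (\<forall>i. x $ i - t $ i \<in> {0..<1})"
    and "0 \<in> L" "v \<in> L" "v \<noteq> 0"
  shows "\<exists>i. v $ i \<in> \<int> \<and> v $ i \<noteq> 0"
proof (rule ccontr)
  assume "\<not> ?thesis"
  then have "- v $ i = 0" if "- v $ i \<in> \<int>" for i
    using that by (auto simp: minus_in_Ints_iff)
  then have "\<exists>E. fundamental_domain E \<and> 0 \<in> E \<and> - v $ i \<in> E" for i
    using fundamental_domain_through[of "- v $ i"] by (metis)
  then obtain E where E: "\<And>i. fundamental_domain (E i)" "\<And>i. 0 \<in> E i" "\<And>i. - v $ i \<in> E i"
    by metis
  have "\<exists>!t. t \<in> L \<and> (\<forall>i. 0 $ i - t $ i \<in> E i)"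
    using tiling_replace_domains[where S = UNIV and x = 0, OF tile E(1)] by simp
  moreover have "\<forall>i. 0 $ i - 0 $ i \<in> E i" "\<forall>i. 0 $ i - v $ i \<in> E i"
    using E by simp_all
  ultimately show False using assms(2-4) by blast
qed

subsection \<open>Vectors on coordinate axes\<close>

lemma finite_rational_common_denominator:
  fixes V :: "real set"
  assumes "finite V" "V \<subseteq> \<rat>"
  obtains N :: nat where "N > 0" "\<And>r. r \<in> V \<Longrightarrow> real N * r \<in> \<int>"
proof -
  have "\<exists>N::nat. N > 0 \<and> (\<forall>r\<in>V. real N * r \<in> \<int>)"
    using assms
  proof (induction V rule: finite_induct)
    case empty
    then show ?case by (intro exI[of _ 1]) auto
  next
    case (insert r V)
    then obtain N :: nat where N: "N > 0" "\<forall>r\<in>V. real N * r \<in> \<int>" by auto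
    obtain a b :: int where ab: "b > 0" "r = of_int a / of_int b"
      using insert.prems by (metis Rats_cases' insert_subset)
    have "real (nat b * N) * r = of_int (int N * a)"
      using ab by simp
    then have "real (nat b * N) * r \<in> \<int>" by (metis Ints_of_int)
    moreover have "real (nat b * N) * s \<in> \<int>" if "s \<in> V" for s
    proof -
      have "of_int b * (real N * s) \<in> \<int>" using N that by (intro Ints_mult[OF Ints_of_int]) blast
      moreover have "real (nat b * N) * s = of_int b * (real N * s)" using ab by simp
      ultimately show ?thesis by metis
    qed
    ultimately show ?case using N ab by (intro exI[of _ "nat b * N"]) auto
  qed
  then show ?thesis using that by blast
qed

definition vanishing :: "'k set \<Rightarrow> (real ^ 'k) set" where
  "vanishing S = {x. \<forall>i\<in>S. x $ i = 0}"

lemma additive_subgroup_vanishing: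
  "additive_subgroup L \<Longrightarrow> additive_subgroup (L \<inter> vanishing S)"
  by (auto simp: additive_subgroup_def vanishing_def)

text \<open>A relatively dense discrete subgroup is generated by its short vectors: walk from \<open>w\<close>
  to the origin in steps of bounded length.\<close>

lemma relatively_dense_rational_coordinate:
  fixes W :: "(real ^ 'k) set"
  assumes W: "additive_subgroup W" "W \<subseteq> vanishing S"
    and fin: "\<And>R. finite (W \<inter> cball 0 R)"
    and dense: "\<And>x. x \<in> vanishing S \<Longrightarrow> \<exists>w\<in>W. norm (x - w) \<le> C"
    and rat: "\<And>w. w \<in> W \<Longrightarrow> w $ i \<in> \<rat>"
  obtains N :: nat where "N > 0" "\<And>w. w \<in> W \<Longrightarrow> real N * w $ i \<in> \<int>"
proof -
  \<comment> \<open>Adding 1 makes the step length positive, so that its multiples exceed every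
    norm.\<close>
  define B where "B = C + 1"
  obtain w :: "real ^ 'k" where "norm (0 - w) \<le> C" using dense[of 0] by (auto simp: vanishing_def)
  then have "C \<ge> 0" using norm_ge_zero order_trans by blast
  then have B: "B \<ge> 1" "C \<le> B" by (auto simp: B_def)
  have "finite ((\<lambda>w. w $ i) ` (W \<inter> cball 0 (3 * B)))" using fin by blast
  moreover have "(\<lambda>w. w $ i) ` (W \<inter> cball 0 (3 * B)) \<subseteq> \<rat>" using rat by auto
  ultimately obtain N :: nat where N: "N > 0"
      "\<And>w. w \<in> W \<Longrightarrow> norm w \<le> 3 * B \<Longrightarrow> real N * w $ i \<in> \<int>"
    by (rule finite_rational_common_denominator) auto
  have "real N * w $ i \<in> \<int>" if "w \<in> W" "norm w \<le> real k * B" for w k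
    using that
  proof (induction k arbitrary: w)
    case 0
    then show ?case using B by simp
  next
    case (Suc k)
    show ?case
    proof (cases "norm w \<le> 3 * B")
      case True
      then show ?thesis using N Suc by blast
    next
      case False
      \<comment> \<open>The point \<open>x\<close> lies between 0 and \<open>w\<close>, at distance
        \<open>2 * B\<close> from \<open>w\<close>. An element \<open>u\<close> of \<open>W\<close>
        within \<open>B\<close> of \<open>x\<close> is shorter than \<open>w\<close> by at least
        \<open>B\<close>, and \<open>w - u\<close> is still among the short vectors cleared by
        \<open>N\<close>.\<close>
      define x where "x = (1 - 2 * B / norm w) *\<^sub>R w"
      have n0: "norm w > 0" using False B by linarith
      have "2 * B / norm w \<le> 1" using False B n0 by (simp add: field_simps)
      then have nx: "norm x = norm w - 2 * B" using n0 by (simp add: x_def field_simps)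
      have "w - x = (2 * B / norm w) *\<^sub>R w" by (simp add: x_def algebra_simps)
      then have nwx: "norm (w - x) = 2 * B" using n0 B by simp
      have "x \<in> vanishing S" using Suc W by (auto simp: x_def vanishing_def)
      then obtain u where u: "u \<in> W" "norm (x - u) \<le> B" using dense B by (meson order_trans)
      have "norm u \<le> norm x + norm (x - u)"
        by (metis norm_minus_commute norm_triangle_sub)
      also have "\<dots> \<le> real k * B" using nx u Suc.prems(2) by (simp add: algebra_simps)
      finally have 1: "real N * u $ i \<in> \<int>" using Suc.IH u by blast
      have "norm (w - u) \<le> norm (w - x) + norm (x - u)"
        by (metis diff_add_cancel add_diff_eq norm_triangle_ineq)
      then have "norm (w - u) \<le> 3 * B" using nwx u by linarith
      then have 2: "real N * (w - u) $ i \<in> \<int>"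
        using N W(1) u Suc.prems by (blast intro: additive_subgroup_diff)
      have "real N * w $ i = real N * u $ i + real N * (w - u) $ i" by (simp add: algebra_simps)
      then show ?thesis using 1 2 by simp
    qed
  qed
  moreover have "\<exists>k. norm w \<le> real k * B" for w :: "real ^ 'k"
    using B reals_Archimedean3[of B] by (meson less_imp_le less_le_trans zero_less_one)
  ultimately show ?thesis using that[OF N(1)] by metis
qed

text \<open>Bounded denominators leave finitely many values for the coordinate \<open>i\<close> of
  those vectors of \<open>W\<close> that approximate points with vanishing coordinate
  \<open>i\<close>. Subtracting a fixed vector of \<open>W\<close> with the same value makes this
  coordinate 0 at a bounded cost.\<close>

lemma relatively_dense_insert:
  fixes W :: "(real ^ 'k) set"
  assumes W: "additive_subgroup W" "W \<subseteq> vanishing S"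
    and fin: "\<And>R. finite (W \<inter> cball 0 R)"
    and dense: "\<And>x. x \<in> vanishing S \<Longrightarrow> \<exists>w\<in>W. norm (x - w) \<le> C"
    and rat: "\<And>w. w \<in> W \<Longrightarrow> w $ i \<in> \<rat>"
  shows "\<exists>C'. \<forall>x \<in> vanishing (insert i S). \<exists>w\<in>W \<inter> vanishing {i}. norm (x - w) \<le> C'"
proof -
  obtain N :: nat where N: "N > 0" "\<And>w. w \<in> W \<Longrightarrow> real N * w $ i \<in> \<int>"
    using relatively_dense_rational_coordinate[OF W fin dense rat] by blast
  define V where "V = {w $ i | w. w \<in> W \<and> \<bar>w $ i\<bar> \<le> C}"
  have "V \<subseteq> (\<lambda>k. of_int k / real N) ` {- \<lceil>real N * C\<rceil>..\<lceil>real N * C\<rceil>}"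
  proof
    fix r assume "r \<in> V"
    then obtain w where w: "w \<in> W" "r = w $ i" "\<bar>r\<bar> \<le> C" by (auto simp: V_def)
    obtain k where k: "real N * r = of_int k" using N w by (auto elim: Ints_cases)
    have "\<bar>real N * r\<bar> \<le> real N * C" using w by (simp add: abs_mult mult_left_mono)
    then have "\<bar>k\<bar> \<le> \<lceil>real N * C\<rceil>" unfolding k by linarith
    moreover have "r = of_int k / real N" using k N by (simp add: field_simps)
    ultimately show "r \<in> (\<lambda>k. of_int k / real N) ` {- \<lceil>real N * C\<rceil>..\<lceil>real N * C\<rceil>}"
      by (intro image_eqI[of _ _ k]) auto
  qed
  then have "finite V" using finite_subset by blast
  have "\<forall>r\<in>V. \<exists>w. w \<in> W \<and> w $ i = r" by (auto simp: V_def)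
  then obtain u where u: "\<And>r. r \<in> V \<Longrightarrow> u r \<in> W" "\<And>r. r \<in> V \<Longrightarrow> u r $ i = r" by metis
  define D where "D = (\<Sum>r\<in>V. norm (u r))"
  have D: "norm (u r) \<le> D" if "r \<in> V" for r
    unfolding D_def using \<open>finite V\<close> that by (intro member_le_sum) auto
  have "\<exists>w\<in>W \<inter> vanishing {i}. norm (x - w) \<le> C + D" if x: "x \<in> vanishing (insert i S)" for x
  proof -
    have "x \<in> vanishing S" "x $ i = 0" using x by (auto simp: vanishing_def)
    then obtain w where w: "w \<in> W" "norm (x - w) \<le> C" using dense by blast
    have "\<bar>w $ i\<bar> \<le> C" using component_le_norm_cart[of "x - w" i] w \<open>x $ i = 0\<close> by simp
    then have V: "w $ i \<in> V" using w by (auto simp: V_def)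
    have "w - u (w $ i) \<in> W \<inter> vanishing {i}"
      using W(1) w u V by (auto simp: vanishing_def intro: additive_subgroup_diff)
    moreover have "norm (x - (w - u (w $ i))) \<le> norm (x - w) + norm (u (w $ i))"
      using norm_triangle_ineq[of "x - w" "u (w $ i)"] by (simp add: algebra_simps)
    ultimately show ?thesis using w D[OF V] by (intro bexI[of _ "w - u (w $ i)"]) auto
  qed
  then show ?thesis by blast
qed

text \<open>Coordinates are made to vanish one at a time, keeping the remaining sublattice
  relatively dense in its coordinate subspace. Once this subspace is a line, density yields a
  nonzero lattice vector on it.\<close>

lemma lattice_axis_vector:
  fixes L :: "(real ^ 'k) set"
  assumes L: "additive_subgroup L" and fin: "\<And>R. finite (L \<inter> cball 0 R)"
    and dense: "\<And>x. \<exists>v\<in>L. norm (x - v) \<le> C"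
    and int: "\<And>v. v \<in> L \<Longrightarrow> v \<noteq> 0 \<Longrightarrow> \<exists>i. v $ i \<in> \<int> \<and> v $ i \<noteq> 0"
  obtains v j where "v \<in> L" "v \<noteq> 0" "\<And>i. i \<noteq> j \<Longrightarrow> v $ i = 0"
proof -
  have step: "\<exists>S::'k set. card S = n \<and> (\<exists>C. \<forall>x\<in>vanishing S. \<exists>w\<in>L \<inter> vanishing S. norm (x - w) \<le> C)"
    if "n < CARD('k)" for n
    using that
  proof (induction n)
    case 0
    then show ?case using dense by (intro exI[of _ "{}"]) (auto simp: vanishing_def)
  next
    case (Suc n)
    then obtain S :: "'k set" and C where S: "card S = n"
      and C: "\<And>x. x\<in>vanishing S \<Longrightarrow> \<exists>w\<in>L \<inter> vanishing S. norm (x - w) \<le> C" by auto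
    define W where "W = L \<inter> vanishing S"
    have W: "additive_subgroup W" unfolding W_def using L by (rule additive_subgroup_vanishing)
    have "S \<noteq> UNIV" using S Suc.prems by auto
    \<comment> \<open>A nonzero vector of \<open>W\<close> has a nonzero integer coordinate,
      necessarily outside \<open>S\<close>. Integrality is weakened to rationality to make the
      covering subgroups pure.\<close>
    have "\<exists>i\<in>- S. W \<subseteq> {w. w $ i \<in> \<rat>}"
    proof (rule additive_subgroup_covered_by_pure[OF W])
      show "W \<subseteq> (\<Union>i\<in>- S. {w. w $ i \<in> \<rat>})"
      proof
        fix w assume w: "w \<in> W"
        show "w \<in> (\<Union>i\<in>- S. {w. w $ i \<in> \<rat>})"
        proof (cases "w = 0")
          case True
          then show ?thesis using \<open>S \<noteq> UNIV\<close> by auto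
        next
          case False
          then obtain i where "w $ i \<in> \<int>" "w $ i \<noteq> 0" using int w by (auto simp: W_def)
          moreover have "i \<notin> S" using w calculation by (auto simp: W_def vanishing_def)
          ultimately show ?thesis using Ints_subset_Rats by auto
        qed
      qed
      show "u \<in> {w. w $ i \<in> \<rat>}" if "k > 0" "real k *\<^sub>R u \<in> {w. w $ i \<in> \<rat>}" for i and u :: "real ^ 'k" and k :: nat
      proof -
        have "(real k * u $ i) / real k \<in> \<rat>" using that by (intro Rats_divide) auto
        then show ?thesis using that by simp
      qed
    qed (auto simp: additive_subgroup_def)
    then obtain i where i: "i \<notin> S" "\<And>w. w \<in> W \<Longrightarrow> w $ i \<in> \<rat>" by auto
    have "finite (W \<inter> cball 0 R)" for R
      by (rule finite_subset[OF _ fin[of R]]) (auto simp: W_def)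
    then have "\<exists>C'. \<forall>x \<in> vanishing (insert i S). \<exists>w\<in>W \<inter> vanishing {i}. norm (x - w) \<le> C'"
      using C i(2) by (intro relatively_dense_insert[OF W]) (auto simp: W_def)
    moreover have "W \<inter> vanishing {i} = L \<inter> vanishing (insert i S)"
      by (auto simp: W_def vanishing_def)
    moreover have "card (insert i S) = Suc n" using i S by simp
    ultimately show ?case by metis
  qed
  obtain S :: "'k set" and C where S: "card S = CARD('k) - 1"
      and C: "\<And>x. x\<in>vanishing S \<Longrightarrow> \<exists>w\<in>L \<inter> vanishing S. norm (x - w) \<le> C"
    using step[of "CARD('k) - 1"] by auto
  have "card (- S) = 1" using S by (simp add: Compl_eq_Diff_UNIV card_Diff_subset Suc_leI)
  then obtain j where j: "- S = {j}" by (rule card_1_singletonE)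
  \<comment> \<open>A point of the axis with norm greater than \<open>C\<close> is not approximated
    by 0.\<close>
  define x :: "real ^ 'k" where "x = axis j (\<bar>C\<bar> + 1)"
  have "x \<in> vanishing S" using j by (auto simp: x_def vanishing_def axis_def)
  then obtain w where w: "w \<in> L \<inter> vanishing S" "norm (x - w) \<le> C" using C by blast
  have "norm x \<ge> \<bar>C\<bar> + 1" using component_le_norm_cart[of x j] by (simp add: x_def)
  then have "w \<noteq> 0" using w by auto
  moreover have "w $ i = 0" if "i \<noteq> j" for i using w j that by (auto simp: vanishing_def)
  ultimately show ?thesis using that w by blast
qed

subsection \<open>Packings and limits of lattices\<close>

text \<open>The translates of \<open>D\<close> cut \<open>P\<close> into countably many pieces,
  possibly overlapping. Moved back into \<open>D\<close> the pieces are disjoint by the packing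
  condition, and translations preserve volume.\<close>

lemma blichfeldt:
  fixes v :: "nat \<Rightarrow> 'a::euclidean_space"
  assumes [measurable]: "D \<in> sets borel" "P \<in> sets borel"
    and cover: "\<And>x. \<exists>n. x - v n \<in> D"
    and packing: "\<And>x y m n. x \<in> P \<Longrightarrow> y \<in> P \<Longrightarrow> x - v m = y - v n \<Longrightarrow> m = n"
  shows "emeasure lborel P \<le> emeasure lborel D"
proof -
  define X where "X n = {x \<in> P. x - v n \<in> D}" for n
  define E where "E n = {y \<in> D. v n + y \<in> P}" for n
  have X[measurable]: "X n \<in> sets borel" for n
  proof -
    have "X n = P \<inter> (\<lambda>x. x - v n) -` D" by (auto simp: X_def)
    also have "\<dots> \<in> sets borel" by measurable
    finally show ?thesis .
  qed
  have E_eq: "E n = (+) (v n) -` X n" for n by (auto simp: E_def X_def)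
  have E[measurable]: "E n \<in> sets borel" for n 
    unfolding E_eq using measurable_sets[of "(+) (v n)" borel borel "X n"] by simp
  have meas: "emeasure lborel (X n) = emeasure lborel (E n)" for n
  proof -
    have "emeasure lborel (X n) = emeasure (distr lborel borel ((+) (v n))) (X n)"
      by (simp add: lborel_distr_plus)
    also have "\<dots> = emeasure lborel (E n)" by (simp add: emeasure_distr E_eq)
    finally show ?thesis .
  qed
  have "E m \<inter> E n = {}" if "m \<noteq> n" for m n
    using packing[of "v m + y" "v n + y" m n for y] that by (auto simp: E_def)
  then have disj: "disjoint_family E" by (simp add: disjoint_family_on_def)
  have "P = (\<Union>n. X n)" using cover by (auto simp: X_def)
  then have "emeasure lborel P = emeasure lborel (\<Union>n. X n)" by simp
  also have "\<dots> \<le> (\<Sum>n. emeasure lborel (X n))"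
    by (rule emeasure_subadditive_countably) auto
  also have "\<dots> = (\<Sum>n. emeasure lborel (E n))" by (simp add: meas)
  also have "\<dots> = emeasure lborel (\<Union>n. E n)"
    by (rule suminf_emeasure) (use disj in auto)
  also have "\<dots> \<le> emeasure lborel D" by (rule emeasure_mono) (auto simp: E_def)
  finally show ?thesis .
qed

lemma emeasure_lborel_cbox_cart:
  fixes a b :: "real ^ 'k"
  assumes "\<And>i. a $ i \<le> b $ i"
  shows "emeasure lborel (cbox a b) = ennreal (\<Prod>i\<in>UNIV. b $ i - a $ i)"
proof -
  have "cbox a b \<noteq> {}" using assms by (auto simp: interval_eq_empty_cart not_less)
  then have "measure lborel (cbox a b) = (\<Prod>i\<in>UNIV. b $ i - a $ i)" by (rule content_cbox_cart)
  then show ?thesis by (metis emeasure_eq_ennreal_measure emeasure_lborel_cbox_finite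
    infinity_ennreal_def less_irrefl)
qed

lemma emeasure_lborel_box_cart:
  fixes a b :: "real ^ 'k"
  assumes "\<And>i. a $ i \<le> b $ i"
  shows "emeasure lborel (box a b) = ennreal (\<Prod>i\<in>UNIV. b $ i - a $ i)"
proof -
  have "emeasure lborel (box a b) = emeasure lborel (cbox a b)"
  proof -
    have "a \<bullet> e \<le> b \<bullet> e" if "e \<in> Basis" for e
      using that assms by (auto simp: Basis_vec_def inner_axis)
    then show ?thesis by simp
  qed
  then show ?thesis using emeasure_lborel_cbox_cart[OF assms] by simp
qed

text \<open>The conclusion says that some translate of the open cube of side \<open>c\<close> by
  \<open>L\<close> meets the open cube of side \<open>e\<close> at \<open>x\<close>. Otherwise both
  cubes together would form a set with disjoint translates, although their total volume exceeds the
  volume 1 of a box whose translates cover space.\<close>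

lemma dense_packing_gap:
  fixes L :: "(real ^ 'k) set" and b x :: "real ^ 'k"
  assumes L: "additive_subgroup L" "countable L" "infinite L"
    and b: "\<And>i. b $ i \<ge> 0" "(\<Prod>i\<in>UNIV. b $ i) = 1" "\<And>x. \<exists>v\<in>L. x - v \<in> cbox 0 b"
    and crit: "\<And>v. v \<in> L \<Longrightarrow> (\<And>i. \<bar>v $ i\<bar> < c) \<Longrightarrow> v = 0"
    and e: "0 < e" "e \<le> c" "c ^ CARD('k) + e ^ CARD('k) > 1"
  shows "\<exists>v\<in>L. \<forall>i. v $ i < x $ i + e \<and> x $ i < v $ i + c"
proof (rule ccontr)
  assume contra: "\<not> ?thesis"
  define P1 :: "(real ^ 'k) set" where "P1 = box 0 (\<chi> i. c)"
  define P2 where "P2 = box x (\<chi> i. x $ i + e)"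
  define P where "P = P1 \<union> P2"
  have P1: "p \<in> P1 \<longleftrightarrow> (\<forall>i. 0 < p $ i \<and> p $ i < c)" for p by (simp add: P1_def mem_box_cart)
  have P2: "p \<in> P2 \<longleftrightarrow> (\<forall>i. x $ i < p $ i \<and> p $ i < x $ i + e)" for p
    by (simp add: P2_def mem_box_cart)
  \<comment> \<open>Both cubes have side at most \<open>c\<close>, so \<open>crit\<close> applies to
    differences within either of them.\<close>
  have same: "q - p = 0" if "q - p \<in> L" "(p \<in> P1 \<and> q \<in> P1) \<or> (p \<in> P2 \<and> q \<in> P2)" for p q
  proof (rule crit[OF that(1)])
    fix i show "\<bar>(q - p) $ i\<bar> < c" using that(2) unfolding P1 P2 using e(2)
      by (elim disjE conjE) (drule spec[of _ i], drule spec[of _ i], simp, linarith)+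
  qed
  have diff: "q - p \<notin> L" if "p \<in> P1" "q \<in> P2" for p q
  proof
    assume "q - p \<in> L"
    moreover have "(q - p) $ i < x $ i + e \<and> x $ i < (q - p) $ i + c" for i
      using that(1)[unfolded P1, rule_format, of i] that(2)[unfolded P2, rule_format, of i] by simp
    ultimately show False using contra by blast
  qed
  have pack: "u = w" if "p \<in> P" "q \<in> P" "u \<in> L" "w \<in> L" "p - u = q - w" for p q u w
  proof -
    have eq: "q - p = w - u" "p - q = u - w" using that(5) by (simp_all add: algebra_simps)
    then have "q - p \<in> L" "p - q \<in> L" using L(1) that by (simp_all add: additive_subgroup_diff)
    then have "q - p = 0" using same[of q p] diff[of p q] diff[of q p] that(1,2) unfolding P_def by blast
    then show "u = w" using eq by simp
  qed
  define v where "v = from_nat_into L"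
  have v: "bij_betw v UNIV L" unfolding v_def using L by (intro bij_betw_from_nat_into)
  have "P1 \<inter> P2 = {}" using diff[of p p for p] additive_subgroup_zero[OF L(1)] by auto
  have "emeasure lborel P \<le> emeasure lborel (cbox 0 b)"
  proof (rule blichfeldt)
    show "\<exists>n. y - v n \<in> cbox 0 b" for y
      using b(3)[of y] v unfolding bij_betw_def by (metis imageE)
    show "m = n" if "p \<in> P" "q \<in> P" "p - v m = q - v n" for p q m n
      using pack[OF that(1,2) _ _ that(3)] v unfolding bij_betw_def inj_def by blast
  qed (auto simp: P_def P1_def P2_def)
  also have "\<dots> = 1" using emeasure_lborel_cbox_cart[of 0 b] b by simp
  finally have "emeasure lborel P \<le> 1" .
  moreover have "emeasure lborel P = ennreal (c ^ CARD('k) + e ^ CARD('k))"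
  proof -
    have "emeasure lborel P1 = ennreal (c ^ CARD('k))"
      unfolding P1_def using e by (subst emeasure_lborel_box_cart) auto
    moreover have "emeasure lborel P2 = ennreal (e ^ CARD('k))"
      unfolding P2_def using e by (subst emeasure_lborel_box_cart) auto
    moreover have "emeasure lborel P = emeasure lborel P1 + emeasure lborel P2"
      unfolding P_def using \<open>P1 \<inter> P2 = {}\<close>
      by (intro plus_emeasure[symmetric]) (auto simp: P1_def P2_def)
    ultimately show ?thesis using e by simp
  qed
  ultimately show False using e(3) by (simp add: ennreal_le_1)
qed

section \<open>Limits of sequences of lattices\<close>

text \<open>This is sequential compactness for Kuratowski convergence. The distance functions are
  1-Lipschitz, so their convergence on a countable dense set along a diagonal subsequence extends to
  all points; the limit set consists of the points whose distances tend to 0.\<close>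

lemma convergent_subsequence_of_sets:
  fixes L :: "nat \<Rightarrow> 'a::euclidean_space set"
  assumes ne: "\<And>n. L n \<noteq> {}"
  obtains s M where "strict_mono s"
    "\<And>v. v \<in> M \<Longrightarrow> \<exists>w. (\<forall>k. w k \<in> L (s k)) \<and> w \<longlonglongrightarrow> v"
    "\<And>r w v. strict_mono r \<Longrightarrow> (\<And>k. w k \<in> L (s (r k))) \<Longrightarrow> w \<longlonglongrightarrow> v \<Longrightarrow> v \<in> M"
proof -
  \<comment> \<open>The cutoff supplies the uniform bound for the diagonal argument and does not
    affect which distances tend to 0.\<close>
  define f where "f n x = min 1 (infdist x (L n))" for n x
  obtain D :: "'a set" where D: "countable D" "\<And>X. open X \<Longrightarrow> X \<noteq> {} \<Longrightarrow> \<exists>d\<in>D. d \<in> X"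
    by (rule countable_dense_setE) blast
  have "norm (f n x) \<le> 1" for n x using infdist_nonneg[of x "L n"] by (auto simp: f_def)
  then obtain s :: "nat \<Rightarrow> nat" where s: "strict_mono s"
      "\<And>x. x \<in> D \<Longrightarrow> \<exists>l. (\<lambda>n. f (s n) x) \<longlonglongrightarrow> l"
    using function_convergent_subsequence[OF D(1), of f 1] by blast
  have lip: "\<bar>f n x - f n y\<bar> \<le> dist x y" for n x y
    using infdist_triangle_abs[of x "L n" y] unfolding f_def by linarith
  have conv: "convergent (\<lambda>n. f (s n) x)" for x
  proof (rule Cauchy_convergent, rule metric_CauchyI)
    fix e :: real assume "e > 0"
    then obtain d where d: "d \<in> D" "dist x d < e / 3" using D(2)[of "ball x (e / 3)"] by auto
    have "Cauchy (\<lambda>n. f (s n) d)" using s(2)[OF d(1)] convergent_Cauchy convergent_def by blast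
    then obtain N where N: "\<And>m n. m \<ge> N \<Longrightarrow> n \<ge> N \<Longrightarrow> dist (f (s m) d) (f (s n) d) < e / 3"
      using \<open>e > 0\<close> by (metis metric_CauchyD divide_pos_pos zero_less_numeral)
    have "dist (f (s m) x) (f (s n) x) < e" if "m \<ge> N" "n \<ge> N" for m n
      using N[OF that] lip[of "s m" x d] lip[of "s n" x d] d(2) unfolding dist_real_def by linarith
    then show "\<exists>N. \<forall>m\<ge>N. \<forall>n\<ge>N. dist (f (s m) x) (f (s n) x) < e" by blast
  qed
  define M where "M = {x. (\<lambda>n. f (s n) x) \<longlonglongrightarrow> 0}"
  show ?thesis
  proof (rule that[OF s(1), of M])
    fix v assume "v \<in> M"
    then have lim: "(\<lambda>n. f (s n) v) \<longlonglongrightarrow> 0" by (simp add: M_def)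
    \<comment> \<open>The infimum defining the distance need not be attained, hence the slack
      tending to 0.\<close>
    have "\<exists>w\<in>L (s k). dist v w < infdist v (L (s k)) + 1 / real (Suc k)" for k
    proof -
      have "(INF w\<in>L (s k). dist v w) < infdist v (L (s k)) + 1 / real (Suc k)"
        by (simp add: infdist_notempty[OF ne])
      then show ?thesis using ne by (subst (asm) cINF_less_iff) auto
    qed
    then obtain w where w: "\<And>k. w k \<in> L (s k)"
        "\<And>k. dist v (w k) < infdist v (L (s k)) + 1 / real (Suc k)" by metis
    have "\<forall>\<^sub>F k in sequentially. f (s k) v < 1" using lim by (rule order_tendstoD) simp
    then have ev: "\<forall>\<^sub>F k in sequentially. dist v (w k) \<le> f (s k) v + 1 / real (Suc k)"
    proof eventually_elim
      case (elim k)
      then show ?case using w(2)[of k] unfolding f_def by linarith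
    qed
    have "(\<lambda>k. f (s k) v + 1 / real (Suc k)) \<longlonglongrightarrow> 0 + 0"
      using lim LIMSEQ_inverse_real_of_nat by (intro tendsto_add) (simp_all add: inverse_eq_divide)
    then have "(\<lambda>k. dist v (w k)) \<longlonglongrightarrow> 0"
      by (intro tendsto_sandwich[OF _ ev tendsto_const]) auto
    then have "w \<longlonglongrightarrow> v" by (simp add: tendsto_dist_iff[of w] dist_commute)
    then show "\<exists>w. (\<forall>k. w k \<in> L (s k)) \<and> w \<longlonglongrightarrow> v" using w by blast
  next
    fix r :: "nat \<Rightarrow> nat" and w v
    assume r: "strict_mono r" and w: "\<And>k. w k \<in> L (s (r k))" "w \<longlonglongrightarrow> v"
    \<comment> \<open>The distances already converge along \<open>s\<close>, so their limit can be
      computed along the further subsequence \<open>r\<close>.\<close>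
    obtain l where l: "(\<lambda>n. f (s n) v) \<longlonglongrightarrow> l" using conv unfolding convergent_def by blast
    then have "(\<lambda>k. f (s (r k)) v) \<longlonglongrightarrow> l" using r LIMSEQ_subseq_LIMSEQ unfolding o_def by fast
    moreover have "(\<lambda>k. f (s (r k)) v) \<longlonglongrightarrow> 0"
    proof (rule tendsto_sandwich[OF _ _ tendsto_const])
      show "\<forall>\<^sub>F k in sequentially. 0 \<le> f (s (r k)) v" by (simp add: f_def infdist_nonneg)
      show "\<forall>\<^sub>F k in sequentially. f (s (r k)) v \<le> dist (w k) v"
        using infdist_le[OF w(1)] by (simp add: f_def dist_commute min.coboundedI2)
      show "(\<lambda>k. dist (w k) v) \<longlonglongrightarrow> 0" using w(2) by (simp add: tendsto_dist_iff[symmetric])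
    qed
    ultimately show "v \<in> M" using l LIMSEQ_unique by (auto simp: M_def)
  qed
qed

text \<open>Two points at distance less than 1 would differ by a vector excluded by
  \<open>crit\<close>, and a bounded uniformly discrete set is finite.\<close>

lemma finite_separated_cube_cball:
  fixes L :: "(real ^ 'k) set"
  assumes L: "additive_subgroup L" and crit: "\<And>v. v \<in> L \<Longrightarrow> (\<And>i. \<bar>v $ i\<bar> < 1) \<Longrightarrow> v = 0"
  shows "finite (L \<inter> cball 0 R)"
proof -
  have "u = v" if "u \<in> L" "v \<in> L" "dist u v < 1" for u v
  proof -
    have "\<bar>(u - v) $ i\<bar> < 1" for i
      using component_le_norm_cart[of "u - v" i] that(3) by (simp add: dist_norm)
    then have "u - v = 0" using crit L that by (blast intro: additive_subgroup_diff)
    then show ?thesis by simp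
  qed
  then have "uniform_discrete (L \<inter> cball 0 R)"
    unfolding uniform_discrete_def by (intro exI[of _ 1]) auto
  then show ?thesis by (simp add: bounded_Int uniform_discrete_finite_iff[symmetric])
qed

lemma norm_le_sum_abs_cart: "(\<And>i. \<bar>x $ i\<bar> \<le> b i) \<Longrightarrow> norm x \<le> (\<Sum>i\<in>UNIV. b i)"
  for x :: "real ^ 'k"
  by (rule order_trans[OF norm_le_l1_cart]) (rule sum_mono)

text \<open>Both \<open>crit\<close> and \<open>gap\<close> pass to the limit with \<open>c\<close>
  replaced by 1 and arbitrarily small \<open>e\<close>. The first makes the half-open unit cubes at
  the points of \<open>M\<close> disjoint; the second, together with discreteness of
  \<open>M\<close>, makes them cover space.\<close>

lemma limit_lattice_tiling:
  fixes L :: "nat \<Rightarrow> (real ^ 'k) set" and c :: "nat \<Rightarrow> real"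
  assumes sub: "\<And>n. additive_subgroup (L n)"
    and crit: "\<And>n v. v \<in> L n \<Longrightarrow> (\<And>i. \<bar>v $ i\<bar> < c n) \<Longrightarrow> v = 0"
    and gap: "\<And>n x e. 0 < e \<Longrightarrow> e \<le> c n \<Longrightarrow> c n ^ CARD('k) + e ^ CARD('k) > 1 \<Longrightarrow>
      \<exists>v\<in>L n. \<forall>i. v $ i < x $ i + e \<and> x $ i < v $ i + c n"
    and c: "\<And>n. c n < 1" "c \<longlonglongrightarrow> 1"
    and s: "strict_mono s"
    and M1: "\<And>v. v \<in> M \<Longrightarrow> \<exists>w. (\<forall>k. w k \<in> L (s k)) \<and> w \<longlonglongrightarrow> v"
    and M2: "\<And>r w v. strict_mono r \<Longrightarrow> (\<And>k. w k \<in> L (s (r k))) \<Longrightarrow> w \<longlonglongrightarrow> v \<Longrightarrow> v \<in> M"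
  shows "additive_subgroup M"
    and "\<And>v. v \<in> M \<Longrightarrow> (\<And>i. \<bar>v $ i\<bar> < 1) \<Longrightarrow> v = 0"
    and "\<And>x. \<exists>!v. v \<in> M \<and> (\<forall>i. x $ i - v $ i \<in> {0..<1})"
proof -
  have id: "v \<in> M" if "\<And>k. w k \<in> L (s k)" "w \<longlonglongrightarrow> v" for w v
    using M2[of id w v] that by (simp add: strict_mono_id)
  show M: "additive_subgroup M"
    unfolding additive_subgroup_def
  proof (intro conjI ballI)
    show "0 \<in> M" by (rule id[of "\<lambda>_. 0"]) (auto simp: sub additive_subgroup_zero)
    fix u v assume "u \<in> M" "v \<in> M"
    then obtain f g where "\<And>k. f k \<in> L (s k)" "f \<longlonglongrightarrow> u" "\<And>k. g k \<in> L (s k)" "g \<longlonglongrightarrow> v"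
      using M1 by metis
    then show "u - v \<in> M"
      by (intro id[of "\<lambda>k. f k - g k"]) (auto simp: sub additive_subgroup_diff intro: tendsto_diff)
  qed
  have cs: "(\<lambda>k. c (s k)) \<longlonglongrightarrow> 1" using LIMSEQ_subseq_LIMSEQ[OF c(2) s] by (simp add: o_def)
  show crit_M: "v = 0" if v: "v \<in> M" "\<And>i. \<bar>v $ i\<bar> < 1" for v
  proof -
    obtain w where w: "\<And>k. w k \<in> L (s k)" "w \<longlonglongrightarrow> v" using M1 v by metis
    have "\<forall>\<^sub>F k in sequentially. \<bar>w k $ i\<bar> < c (s k)" for i
    proof -
      have "(\<lambda>k. c (s k) - \<bar>w k $ i\<bar>) \<longlonglongrightarrow> 1 - \<bar>v $ i\<bar>"
        using w(2) cs by (intro tendsto_intros)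
      then have "\<forall>\<^sub>F k in sequentially. 0 < c (s k) - \<bar>w k $ i\<bar>"
        using v(2)[of i] by (intro order_tendstoD) auto
      then show ?thesis by simp
    qed
    then have "\<forall>\<^sub>F k in sequentially. \<forall>i. \<bar>w k $ i\<bar> < c (s k)" by (rule eventually_all_finite)
    then have "\<forall>\<^sub>F k in sequentially. w k = 0" by eventually_elim (use crit w(1) in blast)
    then have "w \<longlonglongrightarrow> 0" by (rule tendsto_eventually)
    then show "v = 0" using w(2) LIMSEQ_unique by blast
  qed
  have approx: "\<exists>v\<in>M. \<forall>i. v $ i \<le> x $ i + e \<and> x $ i \<le> v $ i + 1" if "e > 0" "e < 1" for x e
  proof -
    \<comment> \<open>For fixed \<open>e\<close> the limit exceeds 1, so \<open>gap\<close> is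
      available for all large \<open>n\<close>.\<close>
    have "(\<lambda>n. c n ^ CARD('k) + e ^ CARD('k)) \<longlonglongrightarrow> 1 ^ CARD('k) + e ^ CARD('k)"
      using c(2) by (intro tendsto_intros)
    then have "\<forall>\<^sub>F n in sequentially. c n ^ CARD('k) + e ^ CARD('k) > 1"
      by (rule order_tendstoD) (use that in simp)
    moreover have "\<forall>\<^sub>F n in sequentially. c n > e" using c(2) that by (intro order_tendstoD) auto
    ultimately have "\<forall>\<^sub>F n in sequentially. \<exists>v\<in>L n. \<forall>i. v $ i < x $ i + e \<and> x $ i < v $ i + c n"
      by eventually_elim (use gap that in auto)
    then obtain N where N: "\<And>n. n \<ge> N \<Longrightarrow> \<exists>v\<in>L n. \<forall>i. v $ i < x $ i + e \<and> x $ i < v $ i + c n"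
      unfolding eventually_sequentially by blast
    have "s (k + N) \<ge> N" for k using seq_suble[OF s, of "k + N"] by linarith
    then have "\<forall>k. \<exists>v\<in>L (s (k + N)). \<forall>i. v $ i < x $ i + e \<and> x $ i < v $ i + c (s (k + N))"
      using N by blast
    then obtain w where w: "\<And>k. w k \<in> L (s (k + N))"
      "\<And>k i. w k $ i < x $ i + e" "\<And>k i. x $ i < w k $ i + c (s (k + N))" by metis
    have "norm (w k) \<le> (\<Sum>i\<in>UNIV. \<bar>x $ i\<bar> + 1)" for k
    proof (rule norm_le_sum_abs_cart)
      fix i show "\<bar>w k $ i\<bar> \<le> \<bar>x $ i\<bar> + 1"
        using w(2)[of k i] w(3)[of i k] c(1)[of "s (k + N)"] that by linarith
    qed
    then have "bounded (range w)" by (auto intro: boundedI)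
    then obtain v r where r: "strict_mono r" "(w \<circ> r) \<longlonglongrightarrow> v" using bounded_imp_convergent_subsequence by blast
    have "v \<in> M"
      by (rule M2[of "\<lambda>k. r k + N" "w \<circ> r"]) (use r w(1) in \<open>auto simp: strict_mono_def\<close>)
    moreover have "v $ i \<le> x $ i + e \<and> x $ i \<le> v $ i + 1" for i
    proof -
      have lim: "(\<lambda>k. w (r k) $ i) \<longlonglongrightarrow> v $ i" using r(2) by (auto simp: o_def intro: tendsto_vec_nth)
      have "v $ i \<le> x $ i + e"
        by (rule LIMSEQ_le_const2[OF lim]) (use w(2) less_imp_le in blast)
      moreover have "x $ i - 1 \<le> w (r k) $ i" for k
        using w(3)[of i "r k"] c(1)[of "s (r k + N)"] by linarith
      then have "x $ i - 1 \<le> v $ i" by (intro LIMSEQ_le_const[OF lim]) blast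
      ultimately show ?thesis by linarith
    qed
    ultimately show ?thesis by blast
  qed
  fix x
  define e where "e n = 1 / real (n + 2)" for n
  have e: "e n > 0" "e n < 1" for n by (auto simp: e_def)
  \<comment> \<open>Approximating the shifted point \<open>x + e n\<close> instead of
    \<open>x\<close> leaves room for the strict inequality at the open end of the cube.\<close>
  have "\<exists>v\<in>M. \<forall>i. v $ i \<le> x $ i + 2 * e n \<and> x $ i + e n \<le> v $ i + 1" for n
    using approx[OF e[of n], of "\<chi> i. x $ i + e n"] by (simp add: algebra_simps)
  then obtain v where v: "\<And>n. v n \<in> M" "\<And>n i. v n $ i \<le> x $ i + 2 * e n"
      "\<And>n i. x $ i + e n \<le> v n $ i + 1" by metis
  define R where "R = (\<Sum>i\<in>UNIV. \<bar>x $ i\<bar> + 2)"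
  have "norm (v n) \<le> R" for n
    unfolding R_def
  proof (rule norm_le_sum_abs_cart)
    fix i show "\<bar>v n $ i\<bar> \<le> \<bar>x $ i\<bar> + 2"
      using v(2)[of n i] v(3)[of i n] e[of n] by linarith
  qed
  \<comment> \<open>Finitely many candidates remain, so one \<open>u\<close> serves infinitely many
    \<open>n\<close>. Letting \<open>e n\<close> tend to 0 gives \<open>u $ i \<le> x $ i\<close>,
    and a single such \<open>n\<close> gives \<open>x $ i < u $ i + 1\<close>.\<close>
  then have "range v \<subseteq> M \<inter> cball 0 R" using v(1) by auto
  then have "finite (range v)" using finite_separated_cube_cball[OF M crit_M] finite_subset by blast
  then obtain u where u: "infinite {n. v n = u}"
    using pigeonhole_infinite[of UNIV v] by auto
  then have inf: "\<exists>n\<ge>N. v n = u" for N using infinite_nat_iff_unbounded_le by (auto) 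
  have "x $ i - u $ i \<in> {0..<1}" for i
  proof -
    have "u $ i \<le> x $ i"
    proof (rule field_le_epsilon)
      fix d :: real assume "d > 0"
      obtain N where N: "real N > 2 / d" using reals_Archimedean2 by blast
      obtain n where n: "n \<ge> N" "v n = u" using inf by blast
      have "2 / d < real (n + 2)" using N n by simp
      then have "2 * e n < d" using \<open>d > 0\<close> by (simp add: e_def field_simps)
      then show "u $ i \<le> x $ i + d" using v(2)[of n i] n by simp
    qed
    moreover obtain n where "v n = u" using inf by blast
    then have "x $ i < u $ i + 1" using v(3)[of i n] e(1)[of n] by simp
    ultimately show ?thesis by simp
  qed
  moreover have "u \<in> M" using inf[of 0] v(1) by auto
  moreover have "w = u" if "w \<in> M" "\<And>i. x $ i - w $ i \<in> {0..<1}" for w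
  proof -
    have "w - u = 0"
    proof (rule crit_M)
      show "w - u \<in> M" using M that \<open>u \<in> M\<close> by (simp add: additive_subgroup_diff)
      show "\<bar>(w - u) $ i\<bar> < 1" for i using that(2)[of i] calculation(1)[of i] by auto
    qed
    then show ?thesis by simp
  qed
  ultimately show "\<exists>!v. v \<in> M \<and> (\<forall>i. x $ i - v $ i \<in> {0..<1})" by blast
qed

subsection \<open>The lattices of a matrix\<close>

lemma powr_inverse_less_iff:
  fixes y :: real
  assumes "a > 0" "r > 0" "y \<ge> 0"
  shows "y powr (1 / a) < r \<longleftrightarrow> y < r powr a"
proof -
  have y: "(y powr (1 / a)) powr a = y" using assms by (simp add: powr_powr)
  show ?thesis
  proof
    assume "y powr (1 / a) < r"
    then show "y < r powr a" using powr_less_mono2[of a "y powr (1 / a)" r] assms y by simp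
  next
    assume "y < r powr a"
    then show "y powr (1 / a) < r"
      using powr_mono2[of a r "y powr (1 / a)"] assms y by (cases "y powr (1 / a) < r") auto
  qed
qed

lemma wnorm_less_iff:
  assumes "\<And>i. w $ i > 0" "r > 0"
  shows "wnorm w x < r \<longleftrightarrow> (\<forall>i. \<bar>x $ i\<bar> < r powr (w $ i))"
  unfolding wnorm_def using assms by (subst Max_less_iff) (auto simp: powr_inverse_less_iff)

lemma wnorm_nonneg: "wnorm w x \<ge> 0"
  unfolding wnorm_def by (subst Max_ge_iff) auto

lemma real_vec_diff: "real_vec (p - q) = real_vec p - real_vec q"
  by (simp add: real_vec_def vec_eq_iff)

text \<open>The lattice point \<open>(A q - p, q)\<close> is moved by a diagonal matrix, which for
  \<open>t > 0\<close> has determinant 1 when both weight vectors sum to 1.\<close>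

definition flow_vec :: "real ^ 'm \<Rightarrow> real ^ 'n \<Rightarrow> real ^ 'n ^ 'm \<Rightarrow> real \<Rightarrow>
    int ^ 'm \<Rightarrow> int ^ 'n \<Rightarrow> real ^ ('m + 'n)" where
  "flow_vec \<alpha> \<beta> A t p q = (\<chi> k. case k of
     Inl i \<Rightarrow> t powr (\<alpha> $ i) * (A *v real_vec q - real_vec p) $ i
   | Inr j \<Rightarrow> real_vec q $ j / t powr (\<beta> $ j))"

lemma flow_vec_nth [simp]:
  "flow_vec \<alpha> \<beta> A t p q $ Inl i = t powr (\<alpha> $ i) * (A *v real_vec q - real_vec p) $ i"
  "flow_vec \<alpha> \<beta> A t p q $ Inr j = real_vec q $ j / t powr (\<beta> $ j)"
  by (simp_all add: flow_vec_def)

definition flow_lattice :: "real ^ 'm \<Rightarrow> real ^ 'n \<Rightarrow> real ^ 'n ^ 'm \<Rightarrow> real \<Rightarrow>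
    (real ^ ('m + 'n)) set" where
  "flow_lattice \<alpha> \<beta> A t = {flow_vec \<alpha> \<beta> A t p q | p q. True}"

lemma vec_eq_iff_sum:
  fixes x y :: "'a ^ ('m::finite + 'n::finite)"
  shows "x = y \<longleftrightarrow> (\<forall>i. x $ Inl i = y $ Inl i) \<and> (\<forall>j. x $ Inr j = y $ Inr j)"
  unfolding vec_eq_iff split_sum_all ..

lemma flow_vec_diff:
  "flow_vec \<alpha> \<beta> A t p q - flow_vec \<alpha> \<beta> A t p' q' = flow_vec \<alpha> \<beta> A t (p - p') (q - q')"
  unfolding vec_eq_iff_sum
proof (intro conjI allI)
  fix i
  have "A *v (real_vec q - real_vec q') = A *v real_vec q - A *v real_vec q'"
    by (rule matrix_vector_mult_diff_distrib)
  then show "(flow_vec \<alpha> \<beta> A t p q - flow_vec \<alpha> \<beta> A t p' q') $ Inl i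
      = flow_vec \<alpha> \<beta> A t (p - p') (q - q') $ Inl i"
    unfolding vector_minus_component flow_vec_nth real_vec_diff
    by (simp add: right_diff_distrib)
next
  fix j
  show "(flow_vec \<alpha> \<beta> A t p q - flow_vec \<alpha> \<beta> A t p' q') $ Inr j
      = flow_vec \<alpha> \<beta> A t (p - p') (q - q') $ Inr j"
    unfolding vector_minus_component flow_vec_nth real_vec_diff
    by (simp add: diff_divide_distrib)
qed

lemma flow_vec_zero: "flow_vec \<alpha> \<beta> A t 0 0 = 0"
  using flow_vec_diff[of \<alpha> \<beta> A t 0 0 0 0] by simp

lemma additive_subgroup_flow_lattice: "additive_subgroup (flow_lattice \<alpha> \<beta> A t)"
  unfolding additive_subgroup_def flow_lattice_def
proof (intro conjI ballI)
  show "0 \<in> {flow_vec \<alpha> \<beta> A t p q |p q. True}" using flow_vec_zero by (metis (mono_tags) mem_Collect_eq)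
  fix u v assume "u \<in> {flow_vec \<alpha> \<beta> A t p q |p q. True}" "v \<in> {flow_vec \<alpha> \<beta> A t p q |p q. True}"
  then obtain p q p' q' where "u = flow_vec \<alpha> \<beta> A t p q" "v = flow_vec \<alpha> \<beta> A t p' q'" by blast
  then have "u - v = flow_vec \<alpha> \<beta> A t (p - p') (q - q')" by (simp add: flow_vec_diff)
  then show "u - v \<in> {flow_vec \<alpha> \<beta> A t p q |p q. True}" by blast
qed

lemma countable_flow_lattice: "countable (flow_lattice \<alpha> \<beta> A t)"
proof -
  have "flow_lattice \<alpha> \<beta> A t = range (\<lambda>(p, q). flow_vec \<alpha> \<beta> A t p q)"
    by (auto simp: flow_lattice_def)
  then show ?thesis by simp
qed

lemma infinite_flow_lattice:
  assumes "t > 0"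
  shows "infinite (flow_lattice \<alpha> \<beta> A t)"
proof
  assume "finite (flow_lattice \<alpha> \<beta> A t)"
  then have "finite (range (\<lambda>k::int. flow_vec \<alpha> \<beta> A t (\<chi> i. k) 0))"
    by (rule rev_finite_subset) (auto simp: flow_lattice_def)
  moreover have "inj (\<lambda>k::int. flow_vec \<alpha> \<beta> A t (\<chi> i. k) 0)"
    using assms by (intro injI) (simp add: vec_eq_iff_sum real_vec_def)
  ultimately show False using finite_imageD infinite_UNIV_int by blast
qed

text \<open>These are the sides of the image of the unit cube under the diagonal matrix. The box
  takes the place of a fundamental domain in the volume comparison.\<close>

definition flow_box :: "real ^ 'm \<Rightarrow> real ^ 'n \<Rightarrow> real \<Rightarrow> real ^ ('m + 'n)" where
  "flow_box \<alpha> \<beta> t = (\<chi> k. case k of Inl i \<Rightarrow> t powr (\<alpha> $ i) | Inr j \<Rightarrow> 1 / t powr (\<beta> $ j))"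

lemma flow_box_nth [simp]:
  "flow_box \<alpha> \<beta> t $ Inl i = t powr (\<alpha> $ i)"
  "flow_box \<alpha> \<beta> t $ Inr j = 1 / t powr (\<beta> $ j)"
  for \<alpha> :: "real ^ 'm" and \<beta> :: "real ^ 'n"
  by (simp_all add: flow_box_def)

lemma prod_flow_box:
  fixes \<alpha> :: "real ^ 'm" and \<beta> :: "real ^ 'n"
  assumes "t > 0" "(\<Sum>i\<in>UNIV. \<alpha> $ i) = 1" "(\<Sum>j\<in>UNIV. \<beta> $ j) = 1"
  shows "(\<Prod>k\<in>UNIV. flow_box \<alpha> \<beta> t $ k) = 1"
proof -
  have "(\<Prod>k\<in>UNIV. flow_box \<alpha> \<beta> t $ k) =
      (\<Prod>i\<in>UNIV. t powr (\<alpha> $ i)) * (\<Prod>j\<in>UNIV. 1 / t powr (\<beta> $ j))"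
    by (subst UNIV_Plus_UNIV[symmetric], subst prod.Plus) simp_all
  also have "\<dots> = t powr (\<Sum>i\<in>UNIV. \<alpha> $ i) / t powr (\<Sum>j\<in>UNIV. \<beta> $ j)"
    using assms(1) by (simp add: powr_sum prod_dividef)
  finally show ?thesis using assms by simp
qed

text \<open>The map from \<open>(p, q)\<close> to \<open>(A q - p, q)\<close> is block triangular,
  so coordinates can be rounded successively: first \<open>q\<close>, then \<open>p\<close> with
  \<open>q\<close> known.\<close>

lemma flow_lattice_cover:
  assumes "t > 0"
  shows "\<exists>v\<in>flow_lattice \<alpha> \<beta> A t. x - v \<in> cbox 0 (flow_box \<alpha> \<beta> t)"
proof -
  define q where "q = (\<chi> j. \<lfloor>x $ Inr j * t powr (\<beta> $ j)\<rfloor>)"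
  \<comment> \<open>The floor is negated because \<open>p\<close> enters the lattice point with a
    minus sign.\<close>
  define p where "p = (\<chi> i. - \<lfloor>x $ Inl i / t powr (\<alpha> $ i) - (A *v real_vec q) $ i\<rfloor>)"
  have "0 \<le> x $ Inr j - real_vec q $ j / t powr (\<beta> $ j) \<and>
      x $ Inr j - real_vec q $ j / t powr (\<beta> $ j) \<le> 1 / t powr (\<beta> $ j)" for j
  proof -
    define b where "b = t powr (\<beta> $ j)"
    have b: "b > 0" using assms by (simp add: b_def)
    have "real_vec q $ j \<le> x $ Inr j * b" "x $ Inr j * b \<le> real_vec q $ j + 1"
      by (simp_all add: real_vec_def q_def b_def)
    then have "real_vec q $ j / b \<le> x $ Inr j" "x $ Inr j \<le> (real_vec q $ j + 1) / b"
      using b by (simp_all add: pos_le_divide_eq pos_divide_le_eq)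
    then show ?thesis unfolding b_def[symmetric] by (simp add: add_divide_distrib)
  qed
  moreover have "0 \<le> x $ Inl i - t powr (\<alpha> $ i) * (A *v real_vec q - real_vec p) $ i \<and>
      x $ Inl i - t powr (\<alpha> $ i) * (A *v real_vec q - real_vec p) $ i \<le> t powr (\<alpha> $ i)" for i
  proof -
    define a where "a = t powr (\<alpha> $ i)"
    have a: "a > 0" using assms by (simp add: a_def)
    define y where "y = (A *v real_vec q) $ i"
    have "real_vec p $ i = - of_int \<lfloor>x $ Inl i / a - y\<rfloor>"
      by (simp add: real_vec_def p_def a_def y_def)
    then have "- real_vec p $ i \<le> x $ Inl i / a - y" "x $ Inl i / a - y \<le> - real_vec p $ i + 1"
      by simp_all
    then have "(y - real_vec p $ i) \<le> x $ Inl i / a" "x $ Inl i / a \<le> (y - real_vec p $ i) + 1"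
      by simp_all
    then have "(y - real_vec p $ i) * a \<le> x $ Inl i" "x $ Inl i \<le> ((y - real_vec p $ i) + 1) * a"
      using a by (simp_all add: pos_le_divide_eq pos_divide_le_eq)
    then show ?thesis unfolding a_def[symmetric] by (simp add: y_def[symmetric] algebra_simps)
  qed
  ultimately have "x - flow_vec \<alpha> \<beta> A t p q \<in> cbox 0 (flow_box \<alpha> \<beta> t)"
    by (simp add: mem_box_cart split_sum_all)
  then show ?thesis unfolding flow_lattice_def by blast
qed

text \<open>Undoing the diagonal matrix turns coordinate bounds into quasi-norm bounds. The
  condition \<open>r \<le> t\<close> forces \<open>q \<noteq> 0\<close>: for \<open>q = 0\<close>
  all coordinates of the integer vector \<open>p\<close> would be below 1 in absolute value.\<close>

lemma flow_lattice_small_vector: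
  fixes \<alpha> :: "real ^ 'm" and \<beta> :: "real ^ 'n"
  assumes \<alpha>: "\<And>i. \<alpha> $ i > 0" and \<beta>: "\<And>j. \<beta> $ j > 0"
    and t: "t > 0" "r \<le> t" and "r > 0" "r' > 0"
    and v: "v \<in> flow_lattice \<alpha> \<beta> A t" "v \<noteq> 0"
    and vi: "\<And>i. \<bar>v $ Inl i\<bar> < r powr (\<alpha> $ i)" and vj: "\<And>j. \<bar>v $ Inr j\<bar> < r' powr (\<beta> $ j)"
  obtains p q where "q \<noteq> 0" "wnorm \<alpha> (A *v real_vec q - real_vec p) < r / t"
    "wnorm \<beta> (real_vec q) < r' * t"
proof -
  obtain p q where pq: "v = flow_vec \<alpha> \<beta> A t p q" using v(1) by (auto simp: flow_lattice_def)
  have i: "\<bar>(A *v real_vec q - real_vec p) $ i\<bar> < (r / t) powr (\<alpha> $ i)" for i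
    using vi[of i] t \<open>r > 0\<close> unfolding pq flow_vec_nth abs_mult
    by (simp add: powr_divide pos_less_divide_eq mult.commute)
  have j: "\<bar>real_vec q $ j\<bar> < (r' * t) powr (\<beta> $ j)" for j
    using vj[of j] t \<open>r' > 0\<close> unfolding pq by (simp add: powr_mult field_simps)
  have "q \<noteq> 0"
  proof
    assume q: "q = 0"
    have "p $ i = 0" for i
    proof -
      have "\<bar>real_of_int (p $ i)\<bar> < (r / t) powr (\<alpha> $ i)"
        using i[of i] by (simp add: q real_vec_def zero_vec_def[symmetric])
      also have "\<dots> \<le> 1" using t \<open>r > 0\<close> \<alpha>[of i] by (intro powr_le1) (auto simp: less_imp_le)
      finally show ?thesis by linarith
    qed
    then have "p = 0" by (simp add: vec_eq_iff)
    then show False using v(2) pq q flow_vec_zero by blast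
  qed
  then show ?thesis
    using that[of q p] i j \<alpha> \<beta> t \<open>r > 0\<close> \<open>r' > 0\<close> by (simp add: wnorm_less_iff)
qed

section \<open>Badly approximable matrices\<close>

lemma BA_lower_bound:
  fixes \<alpha> :: "real ^ 'm" and \<beta> :: "real ^ 'n"
  assumes "A \<in> BA \<alpha> \<beta>"
  obtains \<epsilon> where "\<epsilon> > 0"
    "\<And>p q. q \<noteq> 0 \<Longrightarrow> \<epsilon> \<le> wnorm \<alpha> (A *v real_vec q - real_vec p) * wnorm \<beta> (real_vec q)"
proof -
  define f where "f = (\<lambda>(p :: int ^ 'm, q :: int ^ 'n).
    wnorm \<alpha> (A *v real_vec q - real_vec p) * wnorm \<beta> (real_vec q))"
  define X where "X = (UNIV :: (int ^ 'm) set) \<times> (UNIV - {0} :: (int ^ 'n) set)"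
  have "Inf (f ` X) > 0" using assms unfolding BA_def f_def X_def by simp
  moreover have "bdd_below (f ` X)"
    by (rule bdd_belowI[of _ 0]) (auto simp: f_def wnorm_nonneg)
  then have "Inf (f ` X) \<le> f (p, q)" if "q \<noteq> 0" for p q
    using that by (intro cInf_lower) (auto simp: X_def)
  ultimately show ?thesis using that by (auto simp: f_def)
qed

theorem theorem1p2:
  fixes \<alpha> :: "real ^ 'm" and \<beta> :: "real ^ 'n"
  assumes "\<And>i. \<alpha> $ i > 0" and "\<And>j. \<beta> $ j > 0"
    and "(\<Sum>i\<in>UNIV. \<alpha> $ i) = 1" and "(\<Sum>j\<in>UNIV. \<beta> $ j) = 1"
  shows "BA \<alpha> \<beta> \<subseteq> DI_inf \<alpha> \<beta>"
proof (rule subsetI, rule ccontr)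
  fix A assume A: "A \<in> BA \<alpha> \<beta>" and "A \<notin> DI_inf \<alpha> \<beta>"
  obtain \<epsilon> where \<epsilon>: "\<epsilon> > 0"
    "\<And>p q. q \<noteq> 0 \<Longrightarrow> \<epsilon> \<le> wnorm \<alpha> (A *v real_vec q - real_vec p) * wnorm \<beta> (real_vec q)"
    using BA_lower_bound[OF A] by blast
  \<comment> \<open>The shift by 2 makes \<open>c n\<close> positive already for
    \<open>n = 0\<close>.\<close>
  define c where "c n = 1 - 1 / real (n + 2)" for n
  have c01: "0 < c n" "c n < 1" for n by (simp_all add: c_def)
  have clim: "c \<longlonglongrightarrow> 1" unfolding c_def by real_asymp
  define solvable where "solvable c t \<longleftrightarrow> (\<exists>(p :: int ^ 'm) (q :: int ^ 'n). q \<noteq> 0 \<and>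
      wnorm \<alpha> (A *v real_vec q - real_vec p) < c / t \<and> wnorm \<beta> (real_vec q) < t)" for c t
  \<comment> \<open>No constant \<open>c n\<close> works for \<open>A\<close>, so failures occur
    beyond every bound. The bound \<open>Suc n\<close> provides both \<open>t n \<ge> 1\<close> and
    divergence to infinity.\<close>
  have "\<exists>t\<ge>real (Suc n). \<not> solvable (c n) t" for n
  proof -
    have "A \<notin> D_inf \<alpha> \<beta> (\<lambda>t. c n * psi1 t)"
      using \<open>A \<notin> DI_inf \<alpha> \<beta>\<close> c01[of n] by (auto simp: DI_inf_def)
    then have "\<not> eventually (solvable (c n)) at_top"
      by (simp add: D_inf_def psi1_def solvable_def[abs_def])
    then show ?thesis unfolding eventually_at_top_linorder by blast
  qed
  then obtain t where t: "\<And>n. t n \<ge> real (Suc n)" "\<And>n. \<not> solvable (c n) (t n)"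
    by metis
  have t1: "t n \<ge> 1" for n using t(1)[of n] by simp
  define L where "L n = flow_lattice \<alpha> \<beta> A (t n)" for n
  have sub: "additive_subgroup (L n)" for n unfolding L_def by (rule additive_subgroup_flow_lattice)
  have crit: "v = 0" if v: "v \<in> L n" "\<And>k. \<bar>v $ k\<bar> < c n" for n v
  proof (rule ccontr)
    assume "v \<noteq> 0"
    \<comment> \<open>Each weight is at most 1, as a positive summand of a sum equal to 1, and
      \<open>c n < 1\<close>; hence the cube lies in the box with radii \<open>c n\<close> and
      1.\<close>
    have "\<bar>v $ Inl i\<bar> < c n powr (\<alpha> $ i)" for i
    proof -
      have "\<alpha> $ i \<le> (\<Sum>i\<in>UNIV. \<alpha> $ i)"
        using assms(1) by (intro member_le_sum) (auto simp: less_imp_le)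
      then have "c n powr 1 \<le> c n powr (\<alpha> $ i)"
        using assms(3) c01[of n] by (intro powr_mono') auto
      then show ?thesis using v(2)[of "Inl i"] c01[of n] by simp
    qed
    moreover have "\<bar>v $ Inr j\<bar> < 1 powr (\<beta> $ j)" for j
      using v(2)[of "Inr j"] c01[of n] by simp
    moreover have "t n > 0" "c n \<le> t n" using t1[of n] c01[of n] by auto
    ultimately obtain p q where "q \<noteq> 0" "wnorm \<alpha> (A *v real_vec q - real_vec p) < c n / t n"
        "wnorm \<beta> (real_vec q) < 1 * t n"
      by - (rule flow_lattice_small_vector[OF assms(1,2) _ _ c01(1) zero_less_one
        v(1)[unfolded L_def] \<open>v \<noteq> 0\<close>])
    then show False using t(2)[of n] by (auto simp: solvable_def)
  qed
  have gap: "\<exists>v\<in>L n. \<forall>k. v $ k < x $ k + e \<and> x $ k < v $ k + c n"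
    if "0 < e" "e \<le> c n" "c n ^ CARD('m + 'n) + e ^ CARD('m + 'n) > 1" for n x e
  proof (rule dense_packing_gap[OF sub])
    have "t n > 0" using t1[of n] by simp
    then show "infinite (L n)" "(\<Prod>k\<in>UNIV. flow_box \<alpha> \<beta> (t n) $ k) = 1"
      "\<exists>v\<in>L n. y - v \<in> cbox 0 (flow_box \<alpha> \<beta> (t n))" for y
      unfolding L_def
      by (rule infinite_flow_lattice, rule prod_flow_box[OF _ assms(3,4)], rule flow_lattice_cover)
    show "countable (L n)" unfolding L_def by (rule countable_flow_lattice)
    show "flow_box \<alpha> \<beta> (t n) $ k \<ge> 0" for k by (cases k) simp_all
    show "v = 0" if "v \<in> L n" "\<And>k. \<bar>v $ k\<bar> < c n" for v using crit that by blast
  qed (use that in auto)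
  have "L n \<noteq> {}" for n using additive_subgroup_zero[OF sub] by blast
  then obtain s M where s: "strict_mono s"
    and M1: "\<And>v. v \<in> M \<Longrightarrow> \<exists>w. (\<forall>k. w k \<in> L (s k)) \<and> w \<longlonglongrightarrow> v"
    and M2: "\<And>r w v. strict_mono r \<Longrightarrow> (\<And>k. w k \<in> L (s (r k))) \<Longrightarrow> w \<longlonglongrightarrow> v \<Longrightarrow> v \<in> M"
    by (rule convergent_subsequence_of_sets[of L]) blast
  have M: "additive_subgroup M"
    by (rule limit_lattice_tiling(1)[of L c s M]; fact)
  have crit_M: "v = 0" if "v \<in> M" "\<And>k. \<bar>v $ k\<bar> < 1" for v
    by (rule limit_lattice_tiling(2)[of L c s M]; fact)
  have tile_M: "\<exists>!v. v \<in> M \<and> (\<forall>k. x $ k - v $ k \<in> {0..<1})" for x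
    by (rule limit_lattice_tiling(3)[of L c s M]; fact)
  obtain v j where v: "v \<in> M" "v \<noteq> 0" and axis: "\<And>k. k \<noteq> j \<Longrightarrow> v $ k = 0"
  proof (rule lattice_axis_vector[OF M])
    show "finite (M \<inter> cball 0 R)" for R
      using finite_separated_cube_cball M crit_M by blast
    show "\<exists>v\<in>M. norm (x - v) \<le> (\<Sum>k\<in>(UNIV :: ('m + 'n) set). 1)" for x
    proof -
      obtain v where "v \<in> M" "\<And>k. x $ k - v $ k \<in> {0..<1}" using tile_M by blast
      then show ?thesis by (intro bexI[of _ v] norm_le_sum_abs_cart) (auto simp: less_imp_le)
    qed
    show "\<exists>k. v $ k \<in> \<int> \<and> v $ k \<noteq> 0" if "v \<in> M" "v \<noteq> 0" for v
      using lattice_tiling_integer_coordinate[OF tile_M] additive_subgroup_zero[OF M] that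
      by blast
  qed blast
  obtain w where w: "\<And>k. w k \<in> L (s k)" "w \<longlonglongrightarrow> v" using M1[OF v(1)] by blast
  \<comment> \<open>The lower bound for products of quasi-norms survives the limit: nonzero lattice
    points \<open>w n\<close> converge to \<open>v\<close>, and the powers of \<open>t\<close>
    contributed by the two components cancel in the product.\<close>
  have no: False if r: "r > 0" "r' > 0" "r * r' \<le> \<epsilon>"
    and vi: "\<And>i. \<bar>v $ Inl i\<bar> < r powr (\<alpha> $ i)" and vj: "\<And>j. \<bar>v $ Inr j\<bar> < r' powr (\<beta> $ j)" for r r'
  proof -
    have lim: "(\<lambda>n. \<bar>w n $ k\<bar>) \<longlonglongrightarrow> \<bar>v $ k\<bar>" for k using w(2) by (intro tendsto_intros)
    have "\<forall>\<^sub>F n in sequentially. \<forall>i. \<bar>w n $ Inl i\<bar> < r powr (\<alpha> $ i)"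
      by (intro eventually_all_finite order_tendstoD(2)[OF lim] vi)
    moreover have "\<forall>\<^sub>F n in sequentially. \<forall>j. \<bar>w n $ Inr j\<bar> < r' powr (\<beta> $ j)"
      by (intro eventually_all_finite order_tendstoD(2)[OF lim] vj)
    moreover have "\<forall>\<^sub>F n in sequentially. w n \<noteq> 0"
      using w(2) v(2) by (rule tendsto_imp_eventually_ne)
    \<comment> \<open>Since \<open>t (s n) > n\<close>, this secures the condition
      \<open>r \<le> t (s n)\<close> behind \<open>q \<noteq> 0\<close>.\<close>
    moreover have "\<forall>\<^sub>F n in sequentially. real n \<ge> r"
      using eventually_ge_at_top[of "nat \<lceil>r\<rceil>"] by eventually_elim linarith
    ultimately have "\<forall>\<^sub>F n in sequentially. False"
    proof eventually_elim
      case (elim n)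
      have "r \<le> t (s n)" "t (s n) > 0"
        using elim(4) t(1)[of "s n"] seq_suble[OF s, of n] by linarith+
      then obtain p q where pq: "q \<noteq> 0" "wnorm \<alpha> (A *v real_vec q - real_vec p) < r / t (s n)"
          "wnorm \<beta> (real_vec q) < r' * t (s n)"
        using elim(1,2) by - (rule flow_lattice_small_vector[OF assms(1,2) _ _ r(1,2)
          w(1)[of n, unfolded L_def] elim(3)], auto)
      have "\<epsilon> \<le> wnorm \<alpha> (A *v real_vec q - real_vec p) * wnorm \<beta> (real_vec q)"
        by (rule \<epsilon>(2)[OF pq(1)])
      also have "\<dots> < r / t (s n) * (r' * t (s n))"
        using pq by (intro mult_strict_mono') (auto simp: wnorm_nonneg)
      also have "\<dots> = r * r'" using t1[of "s n"] by (simp add: field_simps)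
      finally show False using r by simp
    qed
    then show False by simp
  qed
  show False
  proof (cases j)
    case (Inl i0)
    \<comment> \<open>One component of \<open>v\<close> has quasi-norm below \<open>r\<close> and
      the other vanishes, so the latter meets the bound with radius \<open>\<epsilon> / r\<close>,
      for which the product of the radii is \<open>\<epsilon>\<close>.\<close>
    define r where "r = wnorm \<alpha> (\<chi> i. v $ Inl i) + 1"
    have r: "r > 0" using wnorm_nonneg[of \<alpha> "\<chi> i. v $ Inl i"] by (simp add: r_def)
    have "wnorm \<alpha> (\<chi> i. v $ Inl i) < r" by (simp add: r_def)
    then have "\<bar>v $ Inl i\<bar> < r powr (\<alpha> $ i)" for i
      using r assms(1) by (simp add: wnorm_less_iff)
    moreover have "\<bar>v $ Inr i\<bar> < (\<epsilon> / r) powr (\<beta> $ i)" for i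
      using axis[of "Inr i"] Inl r \<epsilon>(1) by simp
    ultimately show False using no[of r "\<epsilon> / r"] r \<epsilon>(1) by simp
  next
    case (Inr j0)
    define r where "r = wnorm \<beta> (\<chi> i. v $ Inr i) + 1"
    have r: "r > 0" using wnorm_nonneg[of \<beta> "\<chi> i. v $ Inr i"] by (simp add: r_def)
    have "wnorm \<beta> (\<chi> i. v $ Inr i) < r" by (simp add: r_def)
    then have "\<bar>v $ Inr i\<bar> < r powr (\<beta> $ i)" for i
      using r assms(2) by (simp add: wnorm_less_iff)
    moreover have "\<bar>v $ Inl i\<bar> < (\<epsilon> / r) powr (\<alpha> $ i)" for i
      using axis[of "Inl i"] Inr r \<epsilon>(1) by simp
    ultimately show False using no[of "\<epsilon> / r" r] r \<epsilon>(1) by simp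
  qed
qed

end
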